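(* Let $n\ge3$ and let $C_n$ be the cycle with vertices $v_1,\dots,v_n$ and edges $v_iv_{i+1}$ ($1\le i\le n-1$) and $v_nv_1$. Let $\Phi=(C_n,\hat{\mathbb V},\varphi)$ be a dual unit gain graph and $q=\varphi(e_{12})\varphi(e_{23})\cdots\varphi(e_{n-1,n})\varphi(e_{n1})\in\hat{\mathbb V}$. Then: (i) There is a switching function $\zeta:V\to\hat{\mathbb V}$ such that $\varphi^{\zeta}(e_{i,i+1})=1$ for $i=1,\dots,n-1$ and $\varphi^\zeta(e_{n1})=q$. (ii) Suppose $\hat{\mathbb V}=\hat{\mathbb T}$. Let $\theta\in\hat{\mathbb R}$ be a dual angle with $q=e^{i\theta}$ (for instance $\theta=-i\log(q)$). Then the $n$ eigenvalues of $A(\Phi)$ are $2\cos\!\left(\frac{\theta+2\pi j}{n}\right)$, $j=0,\dots,n-1$, and the $n$ eigenvalues of $L(\Phi)$ are $2-2\cos\!\left(\frac{\theta+2\pi j}{n}\right)$, $j=0,\dots,n-1$. (iii) Suppose $\hat{\mathbb V}=\hat{\mathbb U}$. Then there exist $a\in\hat{\mathbb T}$ and a switching function $\zeta_1:V\to\hat{\mathbb U}$ such that $\varphi^{\zeta_1}(e_{i,i+1})=1$ for $i=1,\dots,n-1$ and $\varphi^{\zeta_1}(e_{n1})=a$; and, with $\theta\in\hat{\mathbb R}$ a dual angle such that $a=e^{i\theta}$ (e.g. $\theta=-i\log(a)$), the eigenvalues of $A(\Phi)$ and $L(\Phi)$ are given by the same formulas as in (ii).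
   Context: Dual elements: $\mathbb G\in\{\mathbb R,\mathbb C,\mathbb H\}$, $\epsilon\ne0$, $\epsilon^2=0$, $\epsilon$ commuting with $\mathbb G$; $\hat{\mathbb G}=\{a_s+a_d\epsilon:a_s,a_d\in\mathbb G\}$ with $(a_s+a_d\epsilon)(b_s+b_d\epsilon)=a_sb_s+(a_sb_d+a_db_s)\epsilon$, conjugate $a^*=a_s^*+a_d^*\epsilon$. Magnitude: $|p|=|p_s|+\frac{p_s^*p_d+p_d^*p_s}{2|p_s|}\epsilon$ if $p_s\ne0$, else $|p_d|\epsilon$. $\hat{\mathbb V}=\{p:|p|=1\}$ (equivalently $|p_s|=1$, $p_sp_d^*+p_dp_s^*=0$); $\hat{\mathbb T}$ and $\hat{\mathbb U}$ denote the unit dual complex numbers and unit dual quaternions. $\hat{\mathbb R}$ = dual numbers ("dual angles"). Dual functions: for $a=a_s+a_d\epsilon\in\hat{\mathbb C}$, $e^{a}=e^{a_s}+a_de^{a_s}\epsilon$; for $a_s\neq0$, $\log(a)=\log(a_s)+a_s^{-1}a_d\epsilon$; for $\theta=\theta_s+\theta_d\epsilon\in\hat{\mathbb R}$, $\cos(\theta)=\cos(\theta_s)-\theta_d\sin(\theta_s)\epsilon$. Gain graphs: each edge $v_iv_j$ gives oriented edges $e_{ij},e_{ji}$; $\varphi$ maps oriented edges to $\hat{\mathbb V}$ with $\varphi(e_{ji})=\varphi(e_{ij})^{-1}$. A switching function $\zeta:V\to\hat{\mathbb V}$ produces $\varphi^\zeta(e_{ij})=\zeta(v_i)^{-1}\varphi(e_{ij})\zeta(v_j)$.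 $A(\Phi)=(a_{ij})$ with $a_{ij}=\varphi(e_{ij})$ if $v_iv_j$ is an edge, else $0$; $L(\Phi)=D-A(\Phi)$ where $D$ is the diagonal matrix of vertex degrees in the underlying graph. Eigenvalues: $\lambda$ is a (right) eigenvalue of $A$ if $A\mathbf x=\mathbf x\lambda$ with $\mathbf x=\mathbf x_s+\mathbf x_d\epsilon$, $\mathbf x_s\ne\mathbf 0$. An $n\times n$ dual Hermitian matrix has exactly $n$ dual-number eigenvalues counted with multiplicity (it is unitarily diagonalizable with dual-number diagonal), called its eigenvalues. *)

theory Defs
  imports
    "HOL-Analysis.Complex_Transcendental"
    "HOL-Analysis.Inner_Product"
    "HOL-Library.Multiset"
    "Jordan_Normal_Form.Matrix"
    "Jordan_Normal_Form.Conjugate"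
begin

unbundle no vec_syntax
unbundle no inner_syntax
hide_const (open) Finite_Cartesian_Product.vec Finite_Cartesian_Product.mat

section \<open>Quaternions\<close>

datatype quat = Quat (QRe: real) (QIm1: real) (QIm2: real) (QIm3: real)

lemma quat_eq_iff: "x = y \<longleftrightarrow> QRe x = QRe y \<and> QIm1 x = QIm1 y \<and> QIm2 x = QIm2 y \<and> QIm3 x = QIm3 y"
  by (cases x; cases y) simp

instantiation quat :: real_vector
begin

definition "0 = Quat 0 0 0 0"
definition "x + y = Quat (QRe x + QRe y) (QIm1 x + QIm1 y) (QIm2 x + QIm2 y) (QIm3 x + QIm3 y)"
definition "- x = Quat (- QRe x) (- QIm1 x) (- QIm2 x) (- QIm3 x)"
definition "x - y = Quat (QRe x - QRe y) (QIm1 x - QIm1 y) (QIm2 x - QIm2 y) (QIm3 x - QIm3 y)"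
definition "r *\<^sub>R x = Quat (r * QRe x) (r * QIm1 x) (r * QIm2 x) (r * QIm3 x)"

instance
  by standard
    (simp_all add: quat_eq_iff zero_quat_def plus_quat_def uminus_quat_def minus_quat_def
      scaleR_quat_def algebra_simps)

end

instantiation quat :: real_inner
begin

definition "inner x y = QRe x * QRe y + QIm1 x * QIm1 y + QIm2 x * QIm2 y + QIm3 x * QIm3 y"
definition "norm x = sqrt ((QRe x)\<^sup>2 + (QIm1 x)\<^sup>2 + (QIm2 x)\<^sup>2 + (QIm3 x)\<^sup>2)"
definition "sgn x = x /\<^sub>R norm (x :: quat)"
definition "dist x y = norm (x - y :: quat)"
definition "(uniformity :: (quat \<times> quat) filter) =
  (INF e\<in>{0 <..}. principal {(x, y). dist x y < e})"
definition "open (U :: quat set) \<longleftrightarrow>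
  (\<forall>x\<in>U. eventually (\<lambda>(x', y). x' = x \<longrightarrow> y \<in> U) uniformity)"

instance
proof
  fix x y z :: quat and r :: real and U :: "quat set"
  show "inner x x = 0 \<longleftrightarrow> x = 0"
  proof -
    have "a\<^sup>2 + b\<^sup>2 + c\<^sup>2 + d\<^sup>2 = 0 \<longleftrightarrow> a = 0 \<and> b = 0 \<and> c = 0 \<and> d = 0" for a b c d :: real
      by (smt (verit) power2_eq_square zero_le_power2 power_eq_0_iff mult_eq_0_iff)
    then show ?thesis
      by (simp add: inner_quat_def quat_eq_iff zero_quat_def flip: power2_eq_square)
  qed
qed (simp_all add: inner_quat_def norm_quat_def sgn_quat_def dist_quat_def uniformity_quat_def
      open_quat_def plus_quat_def scaleR_quat_def algebra_simps power2_eq_square)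

end

instantiation quat :: real_normed_div_algebra
begin

definition "1 = Quat 1 0 0 0"
definition "x * y = Quat
  (QRe x * QRe y - QIm1 x * QIm1 y - QIm2 x * QIm2 y - QIm3 x * QIm3 y)
  (QRe x * QIm1 y + QIm1 x * QRe y + QIm2 x * QIm3 y - QIm3 x * QIm2 y)
  (QRe x * QIm2 y - QIm1 x * QIm3 y + QIm2 x * QRe y + QIm3 x * QIm1 y)
  (QRe x * QIm3 y + QIm1 x * QIm2 y - QIm2 x * QIm1 y + QIm3 x * QRe y)"
definition "inverse x = Quat (QRe x) (- QIm1 x) (- QIm2 x) (- QIm3 x) /\<^sub>R (norm x)\<^sup>2"
definition "x div y = x * inverse (y :: quat)"

instance
proof
  fix x y z :: quat and r :: real
  have nz: "QRe x * QRe x + (QIm1 x * QIm1 x + (QIm2 x * QIm2 x + QIm3 x * QIm3 x)) \<noteq> 0" if "x \<noteq> 0"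
    using that inner_eq_zero_iff[of x] by (simp add: inner_quat_def add.assoc)
  have n2: "(norm w)\<^sup>2 = QRe w * QRe w + (QIm1 w * QIm1 w + (QIm2 w * QIm2 w + QIm3 w * QIm3 w))" for w :: quat
    by (simp add: norm_quat_def power2_eq_square add.assoc)
  show "inverse x * x = 1" "x * inverse x = 1" if "x \<noteq> 0"
    using nz[OF that]
    by (simp_all add: quat_eq_iff inverse_quat_def times_quat_def one_quat_def scaleR_quat_def n2
        divide_simps)
  have "(norm (x * y))\<^sup>2 = (norm x * norm y)\<^sup>2"
    unfolding power_mult_distrib n2 by (simp add: times_quat_def algebra_simps)
  then show "norm (x * y) = norm x * norm y"
    by (simp add: power2_eq_iff_nonneg)
qed (simp_all add: quat_eq_iff times_quat_def one_quat_def zero_quat_def plus_quat_def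
      scaleR_quat_def divide_quat_def inverse_quat_def algebra_simps)

end

definition quat_of_complex :: "complex \<Rightarrow> quat" where
  "quat_of_complex z = Quat (Re z) (Im z) 0 0"

instantiation quat :: conjugate
begin

definition "conjugate x = Quat (QRe x) (- QIm1 x) (- QIm2 x) (- QIm3 x)"

instance
  by standard (auto simp: conjugate_quat_def quat_eq_iff)

end


section \<open>Dual elements\<close>

text \<open>Common interface of the three base algebras; it is used at the types \<^typ>\<open>real\<close>,
  \<^typ>\<open>complex\<close> and \<^typ>\<open>quat\<close>.\<close>

class star_div_algebra = real_normed_div_algebra + conjugate +
  assumes star_add: "conjugate (x + y) = conjugate x + conjugate y"
    and star_mult: "conjugate (x * y) = conjugate y * conjugate x"
    and mult_star_scaleR: "x * conjugate x = (norm x)\<^sup>2 *\<^sub>R 1"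

lemma mult_star: "x * conjugate x = of_real ((norm x)\<^sup>2)" for x :: "'a::star_div_algebra"
  by (simp add: mult_star_scaleR of_real_def)

instance real :: star_div_algebra
  by standard (simp_all add: power2_eq_square)

instance complex :: star_div_algebra
  by standard (simp_all add: complex_mult_cnj cmod_power2 scaleR_conv_of_real)

instance quat :: star_div_algebra
  by standard
    (simp_all add: of_real_def conjugate_quat_def plus_quat_def times_quat_def scaleR_quat_def
      one_quat_def norm_quat_def power2_eq_square algebra_simps)

text \<open>\<open>Dual a b\<close> stands for \<open>a + b \<epsilon>\<close>.\<close>

datatype 'a dual = Dual (std_part: 'a) (dual_part: 'a)

lemma dual_eq_iff: "x = y \<longleftrightarrow> std_part x = std_part y \<and> dual_part x = dual_part y"
  by (cases x; cases y) simp

instantiation dual :: (ring_1) ring_1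
begin

definition "0 = Dual 0 0"
definition "1 = Dual 1 0"
definition "x + y = Dual (std_part x + std_part y) (dual_part x + dual_part y)"
definition "- x = Dual (- std_part x) (- dual_part x)"
definition "x - y = Dual (std_part x - std_part y) (dual_part x - dual_part y)"
definition "x * y = Dual (std_part x * std_part y)
  (std_part x * dual_part y + dual_part x * std_part y)"

instance
  by standard
    (simp_all add: dual_eq_iff zero_dual_def one_dual_def plus_dual_def uminus_dual_def
      minus_dual_def times_dual_def algebra_simps)

end

text \<open>The inverse is only meaningful when the standard part is nonzero.\<close>

instantiation dual :: (division_ring) inverse
begin

definition "inverse x = Dual (inverse (std_part x))
  (- (inverse (std_part x) * dual_part x * inverse (std_part x)))"
definition "x div y = x * inverse (y :: 'a dual)"

instance ..

end

lemma dual_inverse: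
  fixes x :: "'a::division_ring dual"
  assumes "std_part x \<noteq> 0"
  shows "x * inverse x = 1" and "inverse x * x = 1"
  using assms
  by (simp_all add: dual_eq_iff times_dual_def inverse_dual_def one_dual_def mult.assoc)
     (simp_all flip: mult.assoc)

instantiation dual :: (conjugate) conjugate
begin

definition "conjugate x = Dual (conjugate (std_part x)) (conjugate (dual_part x))"

instance
  by standard (auto simp: conjugate_dual_def dual_eq_iff)

end

text \<open>The magnitude is a dual number; it is kept here inside the dual algebra that contains
  \<open>p\<close>, where the dual numbers sit as the image of \<open>map_dual of_real\<close>.\<close>

definition dual_magnitude :: "'a::star_div_algebra dual \<Rightarrow> 'a dual" where
  "dual_magnitude p =
    (if std_part p \<noteq> 0
     then Dual (of_real (norm (std_part p)))
       ((conjugate (std_part p) * dual_part p + conjugate (dual_part p) * std_part p)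
          /\<^sub>R (2 * norm (std_part p)))
     else Dual 0 (of_real (norm (dual_part p))))"

definition dual_units :: "'a::star_div_algebra dual set" where
  "dual_units = {p. dual_magnitude p = 1}"

abbreviation dual_of_real :: "real dual \<Rightarrow> 'a::real_algebra_1 dual" where
  "dual_of_real \<equiv> map_dual of_real"

definition dual_exp :: "complex dual \<Rightarrow> complex dual" where
  "dual_exp a = Dual (exp (std_part a)) (dual_part a * exp (std_part a))"

definition dual_log :: "complex dual \<Rightarrow> complex dual" where
  "dual_log a = Dual (Ln (std_part a)) (inverse (std_part a) * dual_part a)"

definition dual_cos :: "real dual \<Rightarrow> real dual" where
  "dual_cos \<theta> = Dual (cos (std_part \<theta>)) (- (dual_part \<theta> * sin (std_part \<theta>)))"

abbreviation dual_i :: "complex dual" where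
  "dual_i \<equiv> Dual \<i> 0"


section \<open>Dual unit gain graphs\<close>

definition simple_graph :: "'v set \<Rightarrow> 'v set set \<Rightarrow> bool" where
  "simple_graph V E \<longleftrightarrow> finite V \<and> (\<forall>e\<in>E. e \<subseteq> V \<and> card e = 2)"

definition graph_degree :: "'v set set \<Rightarrow> 'v \<Rightarrow> nat" where
  "graph_degree E v = card {e \<in> E. v \<in> e}"

text \<open>The gain of the oriented edge from \<open>u\<close> to \<open>v\<close> is \<open>\<phi> u v\<close>; values of \<open>\<phi>\<close> at
  non-adjacent pairs are irrelevant.\<close>

definition dual_unit_gain_graph ::
    "'v set \<Rightarrow> 'v set set \<Rightarrow> ('v \<Rightarrow> 'v \<Rightarrow> 'a::star_div_algebra dual) \<Rightarrow> bool" where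
  "dual_unit_gain_graph V E \<phi> \<longleftrightarrow> simple_graph V E \<and>
    (\<forall>u v. {u, v} \<in> E \<longrightarrow> \<phi> u v \<in> dual_units \<and> \<phi> v u = inverse (\<phi> u v))"

definition switching_function :: "'v set \<Rightarrow> ('v \<Rightarrow> 'a::star_div_algebra dual) \<Rightarrow> bool" where
  "switching_function V \<zeta> \<longleftrightarrow> (\<forall>v\<in>V. \<zeta> v \<in> dual_units)"

definition switch ::
    "('v \<Rightarrow> 'v \<Rightarrow> 'a::star_div_algebra dual) \<Rightarrow> ('v \<Rightarrow> 'a dual) \<Rightarrow> 'v \<Rightarrow> 'v \<Rightarrow> 'a dual" where
  "switch \<phi> \<zeta> u v = inverse (\<zeta> u) * \<phi> u v * \<zeta> v"

text \<open>The vertices are \<open>1, \<dots>, n\<close>, whereas matrix indices start at 0.\<close>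

definition gain_adjacency_mat ::
    "nat \<Rightarrow> nat set set \<Rightarrow> (nat \<Rightarrow> nat \<Rightarrow> 'a::star_div_algebra dual) \<Rightarrow> 'a dual mat" where
  "gain_adjacency_mat n E \<phi> =
    mat n n (\<lambda>(i, j). if {Suc i, Suc j} \<in> E then \<phi> (Suc i) (Suc j) else 0)"

definition gain_laplacian_mat ::
    "nat \<Rightarrow> nat set set \<Rightarrow> (nat \<Rightarrow> nat \<Rightarrow> 'a::star_div_algebra dual) \<Rightarrow> 'a dual mat" where
  "gain_laplacian_mat n E \<phi> =
    mat_diag n (\<lambda>i. of_nat (graph_degree E (Suc i))) - gain_adjacency_mat n E \<phi>"

definition cycle_edges :: "nat \<Rightarrow> nat set set" where
  "cycle_edges n = {{i, i + 1} | i. 1 \<le> i \<and> i \<le> n - 1} \<union> {{n, 1}}"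

abbreviation cycle_gain_graph :: "nat \<Rightarrow> (nat \<Rightarrow> nat \<Rightarrow> 'a::star_div_algebra dual) \<Rightarrow> bool" where
  "cycle_gain_graph n \<equiv> dual_unit_gain_graph {1..n} (cycle_edges n)"

definition cycle_gain :: "nat \<Rightarrow> (nat \<Rightarrow> nat \<Rightarrow> 'a::star_div_algebra dual) \<Rightarrow> 'a dual" where
  "cycle_gain n \<phi> = prod_list (map (\<lambda>i. \<phi> i (i + 1)) [1..<n]) * \<phi> n 1"

definition switches_cycle_to ::
    "nat \<Rightarrow> (nat \<Rightarrow> nat \<Rightarrow> 'a::star_div_algebra dual) \<Rightarrow> (nat \<Rightarrow> 'a dual) \<Rightarrow> 'a dual \<Rightarrow> bool" where
  "switches_cycle_to n \<phi> \<zeta> p \<longleftrightarrow> switching_function {1..n} \<zeta> \<and>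
    (\<forall>i\<in>{1..n-1}. switch \<phi> \<zeta> i (i + 1) = 1) \<and> switch \<phi> \<zeta> n 1 = p"


section \<open>Eigenvalues of dual matrices\<close>

definition right_eigenvalue :: "'a::star_div_algebra dual mat \<Rightarrow> 'a dual \<Rightarrow> bool" where
  "right_eigenvalue A \<mu> \<longleftrightarrow>
    (\<exists>x \<in> carrier_vec (dim_row A). map_vec std_part x \<noteq> 0\<^sub>v (dim_row A) \<and>
       A *\<^sub>v x = map_vec (\<lambda>y. y * \<mu>) x)"

definition conj_transpose :: "'a::conjugate mat \<Rightarrow> 'a mat" where
  "conj_transpose A = transpose_mat (map_mat conjugate A)"

definition unitary_mat :: "nat \<Rightarrow> 'a::star_div_algebra dual mat \<Rightarrow> bool" where
  "unitary_mat n U \<longleftrightarrow> U \<in> carrier_mat n n \<and>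
     conj_transpose U * U = 1\<^sub>m n \<and> U * conj_transpose U = 1\<^sub>m n"

definition unitarily_diagonalizes ::
    "'a::star_div_algebra dual mat \<Rightarrow> 'a dual mat \<Rightarrow> real dual list \<Rightarrow> bool" where
  "unitarily_diagonalizes U A ls \<longleftrightarrow> A \<in> carrier_mat (length ls) (length ls) \<and>
     unitary_mat (length ls) U \<and>
     conj_transpose U * A * U = mat_diag (length ls) (\<lambda>i. dual_of_real (ls ! i))"

text \<open>\<open>has_eigenvalues A M\<close>: the dual numbers in \<open>M\<close> are precisely the right eigenvalues of
  \<open>A\<close>, and each occurs as often as on the diagonal of a unitary diagonalization of \<open>A\<close>.
  By \<open>unitarily_diagonalizes_unique\<close> below the multiplicities do not depend on the
  diagonalization.\<close>

definition has_eigenvalues :: "'a::star_div_algebra dual mat \<Rightarrow> real dual multiset \<Rightarrow> bool" where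
  "has_eigenvalues A M \<longleftrightarrow>
    {\<mu>. right_eigenvalue A \<mu>} = dual_of_real ` set_mset M \<and>
    (\<exists>U ls. unitarily_diagonalizes U A ls \<and> mset ls = M)"

lemma std_part_sum: "std_part (sum f I) = (\<Sum>i\<in>I. std_part (f i))"
  for f :: "'b \<Rightarrow> 'a::ring_1 dual"
  by (induction I rule: infinite_finite_induct) (simp_all add: zero_dual_def plus_dual_def)

lemma conjugate_zero_star: "conjugate (0 :: 'a::star_div_algebra) = 0"
  using star_add[of "0 :: 'a" 0] by simp

lemma conjugate_dual_add: "conjugate (x + y) = conjugate x + conjugate y"
  and conjugate_dual_mult: "conjugate (x * y) = conjugate y * conjugate x"
  and conjugate_dual_zero: "conjugate (0 :: 'a dual) = 0"
  for x y :: "'a::star_div_algebra dual"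
  by (simp_all add: conjugate_dual_def plus_dual_def times_dual_def zero_dual_def star_add star_mult
      conjugate_zero_star add.commute)

lemma conjugate_dual_sum: "conjugate (sum f I) = (\<Sum>i\<in>I. conjugate (f i))"
  for f :: "'b \<Rightarrow> 'a::star_div_algebra dual"
  by (induction I rule: infinite_finite_induct) (simp_all add: conjugate_dual_add conjugate_dual_zero)

lemma dual_of_real_commute: "dual_of_real r * x = x * dual_of_real r"
  for x :: "'a::star_div_algebra dual"
  by (cases r) (simp add: times_dual_def of_real_def add.commute)

lemma dual_of_real_cancel:
  fixes w :: "'a::star_div_algebra dual"
  assumes "dual_of_real r * w = w * dual_of_real s" and "std_part w \<noteq> 0"
  shows "r = s"
proof -
  have "dual_of_real r * w * inverse w = dual_of_real s * w * inverse w"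
    using assms(1) by (simp add: dual_of_real_commute)
  then have "(dual_of_real r :: 'a dual) = dual_of_real s"
    by (simp add: mult.assoc dual_inverse(1)[OF assms(2)])
  then show ?thesis
    by (cases r; cases s) simp
qed

lemma conj_transpose_carrier: "U \<in> carrier_mat n m \<Longrightarrow> conj_transpose U \<in> carrier_mat m n"
  by (simp add: conj_transpose_def)

lemma unitarily_diagonalizes_unique:
  fixes A :: "'a::star_div_algebra dual mat"
  assumes U: "unitarily_diagonalizes U A ls" and V: "unitarily_diagonalizes V A ms"
  shows "mset ls = mset ms"
proof -
  define n where "n = length ls"
  define D where "D = mat_diag n (\<lambda>i. dual_of_real (ls ! i) :: 'a dual)"
  define E where "E = mat_diag n (\<lambda>i. dual_of_real (ms ! i) :: 'a dual)"
  have A: "A \<in> carrier_mat n n" and lm: "length ms = n"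
    using U V by (auto simp: unitarily_diagonalizes_def n_def)
  let ?U = "conj_transpose U" and ?V = "conj_transpose V"
  have Uc: "U \<in> carrier_mat n n" "?U \<in> carrier_mat n n"
    and Vc: "V \<in> carrier_mat n n" "?V \<in> carrier_mat n n"
    using U V lm by (auto simp: unitarily_diagonalizes_def unitary_mat_def n_def conj_transpose_carrier)
  have U1: "?U * U = 1\<^sub>m n" "U * ?U = 1\<^sub>m n" "?U * A * U = D"
    and V1: "?V * V = 1\<^sub>m n" "V * ?V = 1\<^sub>m n" "?V * A * V = E"
    using U V lm by (auto simp: unitarily_diagonalizes_def unitary_mat_def n_def D_def E_def)
  note cs = Uc Vc A
  define W where "W = ?U * V"
  define W' where "W' = ?V * U"
  have Wc: "W \<in> carrier_mat n n" "W' \<in> carrier_mat n n"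
    using cs by (auto simp: W_def W'_def)
  have WW': "W * W' = 1\<^sub>m n"
  proof -
    have "W * W' = ?U * ((V * ?V) * U)"
      using cs by (simp add: W_def W'_def assoc_mult_mat[of _ n n _ n _ n])
    then show ?thesis using cs by (simp add: V1 U1)
  qed
  have W'W: "W' * W = 1\<^sub>m n"
  proof -
    have "W' * W = ?V * ((U * ?U) * V)"
      using cs by (simp add: W_def W'_def assoc_mult_mat[of _ n n _ n _ n])
    then show ?thesis using cs by (simp add: V1 U1)
  qed
  have DW: "D * W = W * E"
  proof -
    have "D * W = ?U * A * ((U * ?U) * V)"
      using cs by (simp add: W_def U1(3)[symmetric] assoc_mult_mat[of _ n n _ n _ n])
    also have "\<dots> = ?U * ((V * ?V) * (A * V))"
      using cs by (simp add: V1 U1 assoc_mult_mat[of _ n n _ n _ n])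
    also have "\<dots> = W * E"
      using cs by (simp add: W_def V1(3)[symmetric] assoc_mult_mat[of _ n n _ n _ n])
    finally show ?thesis .
  qed
  have W'_index: "W' $$ (j, i) = conjugate (W $$ (i, j))" if "i < n" "j < n" for i j
    using that cs
    by (simp add: W_def W'_def conj_transpose_def scalar_prod_def conjugate_dual_sum conjugate_dual_mult)
  define w where "w i j = (norm (std_part (W $$ (i, j))))\<^sup>2" for i j
  have eq: "ls ! i = ms ! j" if "i < n" "j < n" "w i j \<noteq> 0" for i j
  proof (rule dual_of_real_cancel)
    have "(D * W) $$ (i, j) = (W * E) $$ (i, j)" by (simp add: DW)
    then show "dual_of_real (ls ! i) * W $$ (i, j) = W $$ (i, j) * dual_of_real (ms ! j)"
      using that Wc by (simp add: D_def E_def mat_diag_mult_left[of _ n n] mat_diag_mult_right[of _ n n])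
    show "std_part (W $$ (i, j)) \<noteq> 0" using that by (simp add: w_def)
  qed
  have row: "(\<Sum>j<n. w i j) = 1" if "i < n" for i
  proof -
    have "(W * W') $$ (i, i) = (1 :: 'a dual)" using that by (simp add: WW')
    then have "(\<Sum>j<n. W $$ (i, j) * W' $$ (j, i)) = 1"
      using that Wc by (simp add: scalar_prod_def atLeast0LessThan)
    then have "std_part (\<Sum>j<n. W $$ (i, j) * conjugate (W $$ (i, j))) = 1"
      using that by (simp add: W'_index one_dual_def)
    then have "of_real (\<Sum>j<n. w i j) = (of_real 1 :: 'a)"
      by (simp add: std_part_sum times_dual_def conjugate_dual_def mult_star w_def)
    then show ?thesis by (simp only: of_real_eq_iff)
  qed
  have star_mult_self: "conjugate x * x = of_real ((norm x)\<^sup>2)" for x :: 'a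
  proof (cases "x = 0")
    case False
    have "conjugate x = of_real ((norm x)\<^sup>2) * inverse x"
    proof -
      have "inverse x * (x * conjugate x) = inverse x * of_real ((norm x)\<^sup>2)"
        by (simp only: mult_star)
      then show ?thesis using False
        by (simp add: mult.assoc[symmetric] of_real_def)
    qed
    then show ?thesis using False by (simp add: mult.assoc)
  qed simp
  have col: "(\<Sum>i<n. w i j) = 1" if "j < n" for j
  proof -
    have "(W' * W) $$ (j, j) = (1 :: 'a dual)" using that by (simp add: W'W)
    then have "(\<Sum>i<n. W' $$ (j, i) * W $$ (i, j)) = 1"
      using that Wc by (simp add: scalar_prod_def atLeast0LessThan)
    then have "std_part (\<Sum>i<n. conjugate (W $$ (i, j)) * W $$ (i, j)) = 1"
      using that by (simp add: W'_index one_dual_def)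
    then have "of_real (\<Sum>i<n. w i j) = (of_real 1 :: 'a)"
      by (simp add: std_part_sum times_dual_def conjugate_dual_def star_mult_self w_def)
    then show ?thesis by (simp only: of_real_eq_iff)
  qed
  show ?thesis
  proof (rule multiset_eqI)
    fix l
    let ?I = "{i. i < n \<and> ls ! i = l}" and ?J = "{j. j < n \<and> ms ! j = l}"
    have "real (card ?I) = (\<Sum>i\<in>?I. \<Sum>j<n. w i j)"
      by (simp add: row)
    also have "\<dots> = (\<Sum>i\<in>?I. \<Sum>j\<in>?J. w i j)"
      by (intro sum.cong sum.mono_neutral_right) (auto dest: eq)
    also have "\<dots> = (\<Sum>j\<in>?J. \<Sum>i\<in>?I. w i j)"
      by (rule sum.swap)
    also have "\<dots> = (\<Sum>j\<in>?J. \<Sum>i<n. w i j)"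
      by (intro sum.cong sum.mono_neutral_left) (auto dest: eq)
    also have "\<dots> = real (card ?J)"
      by (simp add: col)
    finally show "count (mset ls) l = count (mset ms) l"
      by (simp add: count_mset count_list_eq_length_filter length_filter_conv_card n_def lm[unfolded n_def] eq_commute[of l])
  qed
qed

end

theory Submission
  imports Defs
begin

text \<open>
  Switching by the inverses of the path gains \<open>\<phi>(e\<^sub>1\<^sub>2) \<cdots> \<phi>(e\<^sub>k\<^sub>-\<^sub>1\<^sub>,\<^sub>k)\<close>, followed by a constant
  unit \<open>u\<close>, moves the whole gain of the cycle to its last edge, where it becomes \<open>u\<^sup>* q u\<close>.
  A unit dual quaternion is conjugate to a unit dual complex number: first rotate the standard
  part into \<open>\<complex>\<close>; then either the standard part is not real and a conjugation by \<open>1 + x \<epsilon>\<close> removes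
  the \<open>j, k\<close> components of the dual part, or it is central and the dual part can be rotated freely.
  If the last edge carries \<open>e\<^sup>i\<^sup>\<theta>\<close>, then the vectors \<open>(\<omega>\<^sup>k)\<^sub>k\<close> with \<open>\<omega>\<close> the dual exponential of
  \<open>i (\<theta> + 2 \<pi> j) / n\<close> are eigenvectors for \<open>\<omega> + \<omega>\<^sup>*\<close>. They are pairwise orthogonal because their
  dual phases cancel and only classical sums of roots of unity remain, so they diagonalize
  \<open>A\<close> and \<open>L = 2 - A\<close> unitarily; a unitary diagonalization with dual-number entries determines
  all right eigenvalues, since dual numbers are central.
\<close>

section \<open>Dual units\<close>

lemma dual_sel [simp]:
  "std_part 0 = 0" "dual_part 0 = 0" "std_part 1 = 1" "dual_part 1 = 0"
  "std_part (x + y) = std_part x + std_part y" "dual_part (x + y) = dual_part x + dual_part y"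
  "std_part (x - y) = std_part x - std_part y" "dual_part (x - y) = dual_part x - dual_part y"
  "std_part (- x) = - std_part x" "dual_part (- x) = - dual_part x"
  "std_part (x * y) = std_part x * std_part y"
  "dual_part (x * y) = std_part x * dual_part y + dual_part x * std_part y"
  for x y :: "'a::ring_1 dual"
  by (simp_all add: zero_dual_def one_dual_def plus_dual_def minus_dual_def uminus_dual_def
      times_dual_def)

instance dual :: (comm_ring_1) comm_ring_1
  by standard (simp_all only: dual_eq_iff dual_sel, simp_all add: algebra_simps)

lemma dual_sel_conjugate [simp]:
  "std_part (conjugate x) = conjugate (std_part x)"
  "dual_part (conjugate x) = conjugate (dual_part x)"
  by (simp_all add: conjugate_dual_def)

lemma dual_sel_of_nat [simp]: "std_part (of_nat n) = of_nat n" "dual_part (of_nat n) = 0"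
  by (induction n) simp_all

lemma dual_sel_numeral [simp]:
  "std_part (numeral k) = numeral k" "dual_part (numeral k) = 0"
  using dual_sel_of_nat[of "numeral k"] by simp_all

lemma conjugate_one_star [simp]: "conjugate (1 :: 'a::star_div_algebra) = 1"
  using mult_star_scaleR[of "1 :: 'a"] by simp

lemma conjugate_mult_self: "conjugate x * x = of_real ((norm x)\<^sup>2)"
  for x :: "'a::star_div_algebra"
proof (cases "x = 0")
  case False
  have "x * (conjugate x * x) = x * of_real ((norm x)\<^sup>2)"
    by (simp add: mult.assoc[symmetric] mult_star of_real_def)
  with False show ?thesis by (subst (asm) mult_left_cancel)
qed simp

lemma dual_units_iff: "p \<in> dual_units \<longleftrightarrow> conjugate p * p = 1"
  for p :: "'a::star_div_algebra dual"
proof (cases "std_part p = 0")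
  case True
  then show ?thesis
    by (simp add: dual_units_def dual_magnitude_def dual_eq_iff)
next
  case False
  have "(of_real (norm (std_part p)) = (1::'a)) \<longleftrightarrow> norm (std_part p) = 1"
    by (metis of_real_1 of_real_eq_iff)
  moreover have "(of_real ((norm (std_part p))\<^sup>2) = (1::'a)) \<longleftrightarrow> norm (std_part p) = 1"
  proof -
    have "(norm (std_part p))\<^sup>2 = 1 \<longleftrightarrow> norm (std_part p) = 1"
      using norm_ge_zero[of "std_part p"] by (auto simp: power2_eq_1_iff simp del: norm_ge_zero)
    then show ?thesis by (metis of_real_1 of_real_eq_iff)
  qed
  ultimately show ?thesis
    using False
    by (auto simp add: dual_units_def dual_magnitude_def dual_eq_iff conjugate_mult_self
        simp del: of_real_power)
qed

lemma dual_units_inverse: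
  fixes p :: "'a::star_div_algebra dual"
  assumes "p \<in> dual_units"
  shows "inverse p = conjugate p" "p * conjugate p = 1" "conjugate p * p = 1"
proof -
  show 1: "conjugate p * p = 1" using assms by (simp add: dual_units_iff)
  then have "std_part (conjugate p * p) = 1" by simp
  then have nz: "std_part p \<noteq> 0" by auto
  have "conjugate p = conjugate p * (p * inverse p)"
    by (simp add: dual_inverse(1)[OF nz])
  also have "\<dots> = inverse p" by (simp add: 1 flip: mult.assoc)
  finally show "inverse p = conjugate p" ..
  then show "p * conjugate p = 1" using dual_inverse(1)[OF nz] by simp
qed

lemma conjugate_dual_one [simp]: "conjugate (1 :: 'a::star_div_algebra dual) = 1"
  by (simp add: dual_eq_iff conjugate_zero_star)

lemma dual_units_one [simp]: "1 \<in> dual_units"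
  by (simp add: dual_units_iff)

lemma dual_units_mult:
  fixes p q :: "'a::star_div_algebra dual"
  assumes "p \<in> dual_units" "q \<in> dual_units"
  shows "p * q \<in> dual_units"
proof -
  have "conjugate (p * q) * (p * q) = conjugate q * (conjugate p * p) * q"
    by (simp add: conjugate_dual_mult mult.assoc)
  then show ?thesis using assms by (simp add: dual_units_iff)
qed

lemma dual_units_conjugate:
  fixes p :: "'a::star_div_algebra dual"
  assumes "p \<in> dual_units"
  shows "conjugate p \<in> dual_units"
  using assms by (simp add: dual_units_iff[of "conjugate p"] dual_units_inverse)

section \<open>Switching a cycle\<close>

definition path_gain :: "(nat \<Rightarrow> nat \<Rightarrow> 'a::star_div_algebra dual) \<Rightarrow> nat \<Rightarrow> 'a dual" where
  "path_gain \<phi> k = prod_list (map (\<lambda>i. \<phi> i (i + 1)) [1..<k])"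

lemma path_gain_Suc: "1 \<le> k \<Longrightarrow> path_gain \<phi> (Suc k) = path_gain \<phi> k * \<phi> k (k + 1)"
  by (simp add: path_gain_def)

lemma cycle_gain_path: "cycle_gain n \<phi> = path_gain \<phi> n * \<phi> n 1"
  by (simp add: cycle_gain_def path_gain_def)

lemma cycle_edgesI: "1 \<le> k \<Longrightarrow> k < n \<Longrightarrow> {k, k + 1} \<in> cycle_edges n" "{n, 1} \<in> cycle_edges n"
proof -
  assume "1 \<le> k" "k < n"
  then show "{k, k + 1} \<in> cycle_edges n"
    unfolding cycle_edges_def by (intro UnI1 CollectI exI[of _ k]) auto
qed (simp add: cycle_edges_def)

lemma cycle_gain_graph_step:
  assumes "cycle_gain_graph n \<phi>"
  shows "1 \<le> k \<Longrightarrow> k < n \<Longrightarrow> \<phi> k (k + 1) \<in> dual_units"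
    and "1 \<le> k \<Longrightarrow> k < n \<Longrightarrow> \<phi> (k + 1) k = inverse (\<phi> k (k + 1))"
    and "\<phi> n 1 \<in> dual_units" and "\<phi> 1 n = inverse (\<phi> n 1)"
  using assms cycle_edgesI unfolding dual_unit_gain_graph_def by blast+

lemma path_gain_unit:
  assumes "cycle_gain_graph n \<phi>" "1 \<le> k" "k \<le> n"
  shows "path_gain \<phi> k \<in> dual_units"
  using assms(2,3)
proof (induction k rule: dec_induct)
  case base
  show ?case by (simp add: path_gain_def)
next
  case (step k)
  then show ?case
    using cycle_gain_graph_step(1)[OF assms(1), of k]
    by (simp add: path_gain_Suc dual_units_mult)
qed

lemma cycle_gain_unit:
  assumes "cycle_gain_graph n \<phi>" "1 \<le> n"
  shows "cycle_gain n \<phi> \<in> dual_units"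
  using assms unfolding cycle_gain_path
  by (intro dual_units_mult path_gain_unit cycle_gain_graph_step) auto

lemma ex_switches_cycle_to:
  fixes \<phi> :: "nat \<Rightarrow> nat \<Rightarrow> 'a::star_div_algebra dual"
  assumes G: "cycle_gain_graph n \<phi>" and n: "1 \<le> n" and u: "u \<in> dual_units"
  shows "\<exists>\<zeta>. switches_cycle_to n \<phi> \<zeta> (conjugate u * cycle_gain n \<phi> * u)"
proof -
  define \<zeta> where "\<zeta> k = conjugate (path_gain \<phi> k) * u" for k
  have P: "path_gain \<phi> k \<in> dual_units" if "1 \<le> k" "k \<le> n" for k
    using path_gain_unit[OF G] that .
  have Z: "\<zeta> k \<in> dual_units" if "1 \<le> k" "k \<le> n" for k
    unfolding \<zeta>_def using P[OF that] u by (intro dual_units_mult dual_units_conjugate)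
  have inv: "inverse (\<zeta> k) = conjugate u * path_gain \<phi> k" if "1 \<le> k" "k \<le> n" for k
    using dual_units_inverse(1)[OF Z[OF that]] by (simp add: \<zeta>_def conjugate_dual_mult)
  have "switch \<phi> \<zeta> k (k + 1) = 1" if k: "1 \<le> k" "k \<le> n - 1" for k
  proof -
    have "switch \<phi> \<zeta> k (k + 1) =
        conjugate u * (path_gain \<phi> (Suc k) * conjugate (path_gain \<phi> (Suc k))) * u"
      using k unfolding switch_def by (subst inv) (auto simp: path_gain_Suc \<zeta>_def mult.assoc)
    then show ?thesis
      using k n P[of "Suc k"] u by (simp add: dual_units_inverse)
  qed
  moreover have "switch \<phi> \<zeta> n 1 = conjugate u * cycle_gain n \<phi> * u"
  proof -
    have "\<zeta> 1 = u"
      by (simp add: \<zeta>_def path_gain_def)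
    then show ?thesis
      using n by (simp add: switch_def inv cycle_gain_path mult.assoc del: One_nat_def)
  qed
  ultimately show ?thesis
    using Z unfolding switches_cycle_to_def switching_function_def by (intro exI[of _ \<zeta>]) auto
qed

section \<open>Eigenvalues from a unitary diagonalization\<close>

lemma std_part_mult_mat_vec_zero:
  fixes A :: "'a::star_div_algebra dual mat"
  assumes "A \<in> carrier_mat m n" "x \<in> carrier_vec n" "map_vec std_part x = 0\<^sub>v n"
  shows "map_vec std_part (A *\<^sub>v x) = 0\<^sub>v m"
proof -
  have "std_part (x $ k) = 0" if "k < n" for k
    using arg_cong[OF assms(3), of "\<lambda>v. v $ k"] that assms(2) by simp
  then show ?thesis
    using assms(1,2) by (intro eq_vecI) (simp_all add: scalar_prod_def std_part_sum)
qed

lemma has_eigenvaluesI: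
  fixes A U :: "'a::star_div_algebra dual mat"
  assumes A: "A \<in> carrier_mat n n" and U: "unitary_mat n U" and n: "length ls = n"
    and AU: "A * U = U * mat_diag n (\<lambda>i. dual_of_real (ls ! i))"
  shows "has_eigenvalues A (mset ls)"
proof -
  let ?D = "mat_diag n (\<lambda>i. dual_of_real (ls ! i)) :: 'a dual mat" and ?V = "conj_transpose U"
  have c: "U \<in> carrier_mat n n" "?V \<in> carrier_mat n n" "?D \<in> carrier_mat n n"
    and VU: "?V * U = 1\<^sub>m n" and UV: "U * ?V = 1\<^sub>m n"
    using U by (auto simp: unitary_mat_def conj_transpose_carrier)
  have VAU: "?V * A * U = ?D"
  proof -
    have "?V * A * U = (?V * U) * ?D"
      using A c AU by (simp add: assoc_mult_mat[of _ n n _ n _ n])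
    then show ?thesis using c VU by simp
  qed
  have VA: "?V * A = ?D * ?V"
  proof -
    have "?V * A = ?V * A * (U * ?V)" using A c UV by simp
    also have "\<dots> = (?V * A * U) * ?V"
      using A c by (simp add: assoc_mult_mat[of _ n n _ n _ n])
    finally show ?thesis by (simp add: VAU)
  qed
  have "right_eigenvalue A (dual_of_real (ls ! j))" if j: "j < n" for j
    unfolding right_eigenvalue_def
  proof (intro bexI conjI)
    let ?x = "col U j"
    show "?x \<in> carrier_vec (dim_row A)" using A c by auto
    have "?V *\<^sub>v ?x = unit_vec n j"
      using c j VU by (simp add: col_mult2[of _ n n _ n, symmetric] del: col_mult2)
    moreover have "map_vec std_part (unit_vec n j :: 'a dual vec) \<noteq> 0\<^sub>v n"
    proof
      assume "map_vec std_part (unit_vec n j :: 'a dual vec) = 0\<^sub>v n"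
      from arg_cong[OF this, of "\<lambda>v. v $ j"] j show False by simp
    qed
    ultimately show "map_vec std_part ?x \<noteq> 0\<^sub>v (dim_row A)"
      using std_part_mult_mat_vec_zero[OF c(2), of ?x] A c by auto
    have "A *\<^sub>v ?x = col (U * ?D) j"
      using A c j by (simp add: col_mult2[of _ n n _ n, symmetric] AU del: col_mult2)
    then show "A *\<^sub>v ?x = map_vec (\<lambda>y. y * dual_of_real (ls ! j)) ?x"
      using c j by (intro eq_vecI) (auto simp: mat_diag_mult_right[of _ n n])
  qed
  moreover have "\<exists>j<n. \<mu> = dual_of_real (ls ! j)" if "right_eigenvalue A \<mu>" for \<mu>
  proof -
    from that A obtain x where x: "x \<in> carrier_vec n" "map_vec std_part x \<noteq> 0\<^sub>v n"
      and Ax: "A *\<^sub>v x = map_vec (\<lambda>y. y * \<mu>) x"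
      by (auto simp: right_eigenvalue_def)
    let ?y = "?V *\<^sub>v x"
    have y: "?y \<in> carrier_vec n" using c x by auto
    have "x = U *\<^sub>v ?y"
      using c x by (simp add: assoc_mult_mat_vec[of _ n n _ n, symmetric] UV del: assoc_mult_mat_vec)
    then have "map_vec std_part ?y \<noteq> 0\<^sub>v n"
      using std_part_mult_mat_vec_zero[OF c(1) y] x by auto
    then obtain j where j: "j < n" "std_part (?y $ j) \<noteq> 0"
      using y by (metis (no_types, lifting) carrier_vecD eq_vecI index_map_vec(1,2) index_zero_vec)
    have "?D *\<^sub>v ?y = ?V *\<^sub>v (A *\<^sub>v x)"
      using A c x by (simp add: assoc_mult_mat_vec[of _ n n _ n, symmetric] VA del: assoc_mult_mat_vec)
    moreover have "(?V *\<^sub>v map_vec (\<lambda>y. y * \<mu>) x) $ j = ?y $ j * \<mu>"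
      using c x j by (simp add: scalar_prod_def sum_distrib_right mult.assoc)
    moreover have "(?D *\<^sub>v ?y) $ j = dual_of_real (ls ! j) * ?y $ j"
    proof -
      have "(?D *\<^sub>v ?y) $ j = (\<Sum>i = 0..<n. (if j = i then dual_of_real (ls ! j) else 0) * ?y $ i)"
        using y j c unfolding mult_mat_vec_def scalar_prod_def
        by (auto simp: mat_diag_def intro!: sum.cong)
      also have "\<dots> = (\<Sum>i = 0..<n. if j = i then dual_of_real (ls ! j) * ?y $ i else 0)"
        by (intro sum.cong) auto
      finally show ?thesis using j by simp
    qed
    ultimately have "?y $ j * \<mu> = ?y $ j * dual_of_real (ls ! j)"
      by (simp add: Ax dual_of_real_commute)
    then have "inverse (?y $ j) * (?y $ j * \<mu>) = inverse (?y $ j) * (?y $ j * dual_of_real (ls ! j))"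
      by simp
    then have "\<mu> = dual_of_real (ls ! j)"
      by (simp add: dual_inverse(2)[OF j(2)] flip: mult.assoc)
    with j show ?thesis by auto
  qed
  moreover have "unitarily_diagonalizes U A ls"
    using A U n VAU by (simp add: unitarily_diagonalizes_def)
  ultimately have "{\<mu>. right_eigenvalue A \<mu>} = (\<lambda>j. dual_of_real (ls ! j)) ` {..<n}"
    by auto
  also have "\<dots> = dual_of_real ` set ls"
    using n by (force simp: set_conv_nth image_iff)
  finally show ?thesis
    using \<open>unitarily_diagonalizes U A ls\<close> by (auto simp: has_eigenvalues_def)
qed

section \<open>The dual Fourier basis\<close>

abbreviation (input) dual_cis :: "real dual \<Rightarrow> complex dual" where
  "dual_cis t \<equiv> dual_exp (dual_i * dual_of_real t)"

lemma dual_cis_sel [simp]: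
  "std_part (dual_cis t) = cis (std_part t)"
  "dual_part (dual_cis t) = \<i> * of_real (dual_part t) * cis (std_part t)"
  by (simp_all add: dual_exp_def dual.map_sel cis_conv_exp mult.commute)

lemma dual_cis_add: "dual_cis (s + t) = dual_cis s * dual_cis t"
  by (simp add: dual_eq_iff flip: cis_mult) (simp add: algebra_simps)

lemma conjugate_dual_cis: "conjugate (dual_cis t) = dual_cis (- t)"
  by (simp add: dual_eq_iff cis_cnj)

lemma dual_cis_zero [simp]: "dual_cis 0 = 1"
  by (simp add: dual_eq_iff)

lemma dual_cis_plus_conjugate:
  "dual_cis t + dual_cis (- t) = dual_of_real (2 * dual_cos t)"
  by (simp add: dual_eq_iff dual.map_sel dual_cos_def complex_eq_iff)

lemma dual_cis_Dual_zero: "dual_cis (Dual x 0) = Dual (cis x) 0"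
  by (simp add: dual_eq_iff del: dual.map)

lemma dual_cis_multiple_2pi: "dual_cis (Dual (2 * pi * real j) 0) = 1"
  unfolding dual_cis_Dual_zero by (simp add: dual_eq_iff cis_multiple_2pi)

lemma sum_cis_roots_unity:
  assumes "i < n" "j < n" "i \<noteq> j"
  shows "(\<Sum>k<n. cis (2 * pi * real k * (real i - real j) / real n)) = 0"
proof -
  define z where "z = cis (2 * pi * (real i - real j) / real n)"
  have n: "n > 0" using assms by simp
  have "cis (2 * pi * real i / real n) \<noteq> cis (2 * pi * real j / real n)"
    using Complex.bij_betw_roots_unity[OF n] assms by (auto simp: bij_betw_def inj_on_def)
  moreover have "cis (2 * pi * real i / real n) = z * cis (2 * pi * real j / real n)"
    by (simp add: z_def cis_mult right_diff_distrib diff_divide_distrib)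
  ultimately have "z \<noteq> 1" by auto
  moreover have "z ^ n = 1"
    using n by (simp add: z_def Complex.DeMoivre cis_multiple_2pi)
  ultimately have "(\<Sum>k<n. z ^ k) = 0" by (simp add: geometric_sum)
  moreover have "z ^ k = cis (2 * pi * real k * (real i - real j) / real n)" for k
    by (simp add: z_def Complex.DeMoivre mult_ac)
  ultimately show ?thesis by simp
qed

lemma sum_Dual_zero: "(\<Sum>k\<in>A. Dual (f k) 0) = Dual (sum f A) (0 :: 'a::ring_1)"
  by (induction A rule: infinite_finite_induct) (simp_all add: dual_eq_iff)

definition cycle_angle :: "nat \<Rightarrow> real dual \<Rightarrow> nat \<Rightarrow> real dual" where
  "cycle_angle n \<theta> j = (\<theta> + Dual (2 * pi * real j) 0) / of_nat n"

definition dual_fourier :: "nat \<Rightarrow> real dual \<Rightarrow> nat \<Rightarrow> nat \<Rightarrow> complex dual" where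
  "dual_fourier n \<theta> j k = dual_cis (of_nat k * cycle_angle n \<theta> j)"

lemma cycle_angle_sel:
  "std_part (cycle_angle n \<theta> j) = (std_part \<theta> + 2 * pi * real j) / real n"
  "dual_part (cycle_angle n \<theta> j) = dual_part \<theta> / real n"
  by (simp_all add: cycle_angle_def divide_dual_def inverse_dual_def divide_inverse)

lemma sum_Dual_cis_roots_unity:
  assumes "i < n" "j < n"
  shows "(\<Sum>k<n. Dual (cis (2 * pi * real k * (real i - real j) / real n)) 0) =
    (if i = j then of_nat n else 0)"
  using sum_cis_roots_unity[of i n j] assms unfolding sum_Dual_zero by (simp add: dual_eq_iff)

lemma dual_fourier_orthogonal_columns:
  assumes "i < n" "j < n"
  shows "(\<Sum>k<n. conjugate (dual_fourier n \<theta> i k) * dual_fourier n \<theta> j k) =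
    (if i = j then of_nat n else 0)"
proof -
  have "conjugate (dual_fourier n \<theta> i k) * dual_fourier n \<theta> j k =
      Dual (cis (2 * pi * real k * (real j - real i) / real n)) 0" for k
    unfolding dual_fourier_def conjugate_dual_cis dual_cis_add[symmetric]
    by (simp add: dual_eq_iff cycle_angle_sel add_divide_distrib diff_divide_distrib algebra_simps)
  then show ?thesis using sum_Dual_cis_roots_unity[OF assms(2,1)] by auto
qed

lemma dual_fourier_orthogonal_rows:
  assumes "k < n" "l < n"
  shows "(\<Sum>j<n. dual_fourier n \<theta> j k * conjugate (dual_fourier n \<theta> j l)) =
    (if k = l then of_nat n else 0)"
proof -
  define c where "c = dual_cis ((of_nat k - of_nat l) * cycle_angle n \<theta> 0)"
  have "dual_fourier n \<theta> j k * conjugate (dual_fourier n \<theta> j l) =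
      c * Dual (cis (2 * pi * real j * (real k - real l) / real n)) 0" for j
  proof -
    have "of_nat k * cycle_angle n \<theta> j + - (of_nat l * cycle_angle n \<theta> j) =
        (of_nat k - of_nat l) * cycle_angle n \<theta> 0 +
        Dual (2 * pi * real j * (real k - real l) / real n) 0"
      by (simp add: dual_eq_iff cycle_angle_sel add_divide_distrib diff_divide_distrib algebra_simps)
    then show ?thesis
      unfolding dual_fourier_def conjugate_dual_cis dual_cis_add[symmetric] c_def
      by (simp only: dual_cis_add dual_cis_Dual_zero)
  qed
  moreover have "c = 1" if "k = l" using that by (simp add: c_def)
  ultimately show ?thesis
    using sum_Dual_cis_roots_unity[OF assms] by (auto simp flip: sum_distrib_left)
qed

definition cyc_succ :: "nat \<Rightarrow> nat \<Rightarrow> nat" where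
  "cyc_succ n k = (if Suc k = n then 0 else Suc k)"

definition cyc_pred :: "nat \<Rightarrow> nat \<Rightarrow> nat" where
  "cyc_pred n k = (if k = 0 then n - 1 else k - 1)"

lemma dual_cis_cycle_angle:
  assumes "n > 0"
  shows "dual_cis (of_nat n * cycle_angle n \<theta> j) = dual_cis \<theta>"
proof -
  have "of_nat n * cycle_angle n \<theta> j = \<theta> + Dual (2 * pi * real j) 0"
    using assms by (simp add: dual_eq_iff cycle_angle_sel)
  then show ?thesis by (simp only: dual_cis_add dual_cis_multiple_2pi mult_1_right)
qed

lemma dual_fourier_succ:
  assumes "k < n"
  shows "(if Suc k = n then dual_cis \<theta> else 1) * dual_fourier n \<theta> j (cyc_succ n k) =
    dual_cis (cycle_angle n \<theta> j) * dual_fourier n \<theta> j k"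
proof -
  have "dual_cis (cycle_angle n \<theta> j) * dual_fourier n \<theta> j k =
      dual_cis (of_nat (Suc k) * cycle_angle n \<theta> j)"
    unfolding dual_fourier_def dual_cis_add[symmetric] by (simp add: algebra_simps)
  moreover have "dual_cis (of_nat (Suc k) * cycle_angle n \<theta> j) = dual_cis \<theta>" if "Suc k = n"
    using dual_cis_cycle_angle[of n \<theta> j] that by auto
  ultimately show ?thesis by (simp add: dual_fourier_def cyc_succ_def del: of_nat_Suc)
qed

lemma dual_fourier_pred:
  assumes "k < n"
  shows "(if k = 0 then dual_cis (- \<theta>) else 1) * dual_fourier n \<theta> j (cyc_pred n k) =
    dual_cis (- cycle_angle n \<theta> j) * dual_fourier n \<theta> j k"
proof (cases k)
  case 0
  obtain m where m: "n = Suc m" using assms by (cases n) auto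
  have "dual_cis (- \<theta>) = conjugate (dual_cis (of_nat n * cycle_angle n \<theta> j))"
    using assms dual_cis_cycle_angle[of n \<theta> j] by (simp add: conjugate_dual_cis)
  then have "dual_cis (- \<theta>) * dual_fourier n \<theta> j m =
      dual_cis (- (of_nat n * cycle_angle n \<theta> j) + of_nat m * cycle_angle n \<theta> j)"
    by (simp only: conjugate_dual_cis dual_fourier_def dual_cis_add)
  also have "- (of_nat n * cycle_angle n \<theta> j) + of_nat m * cycle_angle n \<theta> j = - cycle_angle n \<theta> j"
    by (simp add: m algebra_simps)
  finally show ?thesis using 0 m by (simp add: cyc_pred_def dual_fourier_def)
next
  case (Suc m)
  then have "dual_cis (- cycle_angle n \<theta> j) * dual_fourier n \<theta> j k = dual_fourier n \<theta> j m"
    unfolding dual_fourier_def dual_cis_add[symmetric] by (simp add: algebra_simps)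
  with Suc show ?thesis by (simp add: cyc_pred_def)
qed

section \<open>Spectrum of a switched cycle\<close>

locale star_embedding =
  fixes h :: "complex \<Rightarrow> 'a::star_div_algebra"
  assumes h_add: "h (x + y) = h x + h y"
    and h_mult: "h (x * y) = h x * h y"
    and h_of_real: "h (of_real r) = of_real r"
    and h_cnj: "h (cnj x) = conjugate (h x)"
begin

abbreviation H :: "complex dual \<Rightarrow> 'a dual" where
  "H \<equiv> map_dual h"

lemma h_zero [simp]: "h 0 = 0" and h_one [simp]: "h 1 = 1"
  using h_of_real[of 0] h_of_real[of 1] by simp_all

lemma H_add: "H (x + y) = H x + H y"
  and H_mult: "H (x * y) = H x * H y"
  and H_zero [simp]: "H 0 = 0" and H_one [simp]: "H 1 = 1"
  and H_conjugate: "H (conjugate x) = conjugate (H x)"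
  and H_dual_of_real: "H (dual_of_real r) = dual_of_real r"
  by (simp_all add: dual_eq_iff dual.map_sel h_add h_mult h_cnj h_of_real)

lemma H_sum: "H (sum f A) = (\<Sum>x\<in>A. H (f x))"
  by (induction A rule: infinite_finite_induct) (simp_all add: H_add)

end

lemma cyc_succ_less: "k < n \<Longrightarrow> cyc_succ n k < n" and cyc_pred_less: "k < n \<Longrightarrow> cyc_pred n k < n"
  by (auto simp: cyc_succ_def cyc_pred_def)

lemma cyc_succ_neq_pred: "3 \<le> n \<Longrightarrow> k < n \<Longrightarrow> cyc_succ n k \<noteq> cyc_pred n k"
  by (auto simp: cyc_succ_def cyc_pred_def)

lemma cycle_edges_iff:
  assumes "3 \<le> n" "k < n" "l < n"
  shows "{Suc k, Suc l} \<in> cycle_edges n \<longleftrightarrow> l = cyc_succ n k \<or> l = cyc_pred n k"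
proof -
  have "{Suc k, Suc l} \<in> cycle_edges n \<longleftrightarrow>
      (\<exists>i. 1 \<le> i \<and> i \<le> n - 1 \<and> {Suc k, Suc l} = {i, i + 1}) \<or> {Suc k, Suc l} = {n, 1}"
    by (auto simp: cycle_edges_def)
  also have "\<dots> \<longleftrightarrow> (l = Suc k \<or> k = Suc l) \<or> (Suc k = n \<and> l = 0 \<or> Suc l = n \<and> k = 0)"
  proof -
    have "(\<exists>i. 1 \<le> i \<and> i \<le> n - 1 \<and> {Suc k, Suc l} = {i, i + 1}) \<longleftrightarrow> l = Suc k \<or> k = Suc l"
    proof
      assume "l = Suc k \<or> k = Suc l"
      then show "\<exists>i. 1 \<le> i \<and> i \<le> n - 1 \<and> {Suc k, Suc l} = {i, i + 1}"
        using assms by (intro exI[of _ "min (Suc k) (Suc l)"]) auto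
    qed (auto simp: doubleton_eq_iff)
    then show ?thesis by (auto simp: doubleton_eq_iff)
  qed
  also have "\<dots> \<longleftrightarrow> l = cyc_succ n k \<or> l = cyc_pred n k"
    using assms by (auto simp: cyc_succ_def cyc_pred_def split: if_splits)
  finally show ?thesis .
qed

lemma graph_degree_cycle:
  assumes n: "3 \<le> n" and k: "k < n"
  shows "graph_degree (cycle_edges n) (Suc k) = 2"
proof -
  have "{e \<in> cycle_edges n. Suc k \<in> e} =
      (\<lambda>l. {Suc k, Suc l}) ` {cyc_succ n k, cyc_pred n k}" (is "?L = ?R")
  proof
    show "?R \<subseteq> ?L"
      using n k cycle_edges_iff[OF n k] by (auto simp: cyc_succ_less cyc_pred_less)
    show "?L \<subseteq> ?R"
    proof
      fix e assume e: "e \<in> ?L"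
      then obtain l where "l < n" "e = {Suc k, Suc l}"
      proof -
        from e consider (step) i where "1 \<le> i" "i \<le> n - 1" "e = {i, i + 1}" | (last) "e = {n, 1}"
          by (auto simp: cycle_edges_def)
        then show thesis
        proof cases
          case step
          then have "Suc k = i \<or> Suc k = i + 1" using e by auto
          then show ?thesis using step n that[of "if Suc k = i then i else i - 1"]
            by (auto simp: insert_commute)
        next
          case last
          then have "Suc k = n \<or> Suc k = 1" using e by auto
          then show ?thesis using last n that[of "if Suc k = n then 0 else n - 1"]
            by (auto simp: insert_commute)
        qed
      qed
      with e show "e \<in> ?R" using cycle_edges_iff[OF n k] by auto
    qed
  qed
  moreover have "inj_on (\<lambda>l. {Suc k, Suc l}) {cyc_succ n k, cyc_pred n k}"
    by (auto simp: inj_on_def doubleton_eq_iff)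
  ultimately show ?thesis
    using cyc_succ_neq_pred[OF n k] by (simp add: graph_degree_def card_image)
qed

lemma switched_gain:
  assumes n: "3 \<le> n" and k: "k < n" and G: "cycle_gain_graph n \<phi>"
    and S: "switches_cycle_to n \<phi> \<zeta> p"
  shows "\<phi> (Suc k) (Suc (cyc_succ n k)) * \<zeta> (Suc (cyc_succ n k)) =
      \<zeta> (Suc k) * (if Suc k = n then p else 1)"
    and "\<phi> (Suc k) (Suc (cyc_pred n k)) * \<zeta> (Suc (cyc_pred n k)) =
      \<zeta> (Suc k) * (if k = 0 then conjugate p else 1)"
proof -
  have Z: "\<zeta> v \<in> dual_units" if "1 \<le> v" "v \<le> n" for v
    using S that by (simp add: switches_cycle_to_def switching_function_def)
  have fwd: "\<phi> u v * \<zeta> v = \<zeta> u * g"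
    if "switch \<phi> \<zeta> u v = g" "1 \<le> u" "u \<le> n" for u v g
  proof -
    have "\<zeta> u * g = (\<zeta> u * conjugate (\<zeta> u)) * (\<phi> u v * \<zeta> v)"
      using that dual_units_inverse(1)[OF Z[of u]] by (auto simp: switch_def mult.assoc)
    then show ?thesis using that by (simp add: dual_units_inverse Z)
  qed
  have bwd: "\<phi> v u * \<zeta> u = \<zeta> v * conjugate g"
    if "switch \<phi> \<zeta> u v = g" "\<phi> v u = inverse (\<phi> u v)" "\<phi> u v \<in> dual_units"
      "1 \<le> u" "u \<le> n" "1 \<le> v" "v \<le> n" for u v g
  proof -
    have "conjugate g = conjugate (\<zeta> v) * (\<phi> v u * \<zeta> u)"
      using that dual_units_inverse(1)[OF Z[of u]] dual_units_inverse(1)[OF that(3)]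
      by (auto simp: switch_def conjugate_dual_mult mult.assoc)
    then have "\<zeta> v * conjugate g = (\<zeta> v * conjugate (\<zeta> v)) * (\<phi> v u * \<zeta> u)"
      by (simp add: mult.assoc)
    then show ?thesis using that by (simp add: dual_units_inverse Z)
  qed
  have S1: "switch \<phi> \<zeta> i (i + 1) = 1" if "1 \<le> i" "i < n" for i
    using S that by (auto simp: switches_cycle_to_def)
  have S2: "switch \<phi> \<zeta> n 1 = p"
    using S by (simp add: switches_cycle_to_def)
  show "\<phi> (Suc k) (Suc (cyc_succ n k)) * \<zeta> (Suc (cyc_succ n k)) =
      \<zeta> (Suc k) * (if Suc k = n then p else 1)"
    using fwd[OF S1[of "Suc k"]] fwd[OF S2] k by (auto simp: cyc_succ_def)
  show "\<phi> (Suc k) (Suc (cyc_pred n k)) * \<zeta> (Suc (cyc_pred n k)) =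
      \<zeta> (Suc k) * (if k = 0 then conjugate p else 1)"
  proof (cases "k = 0")
    case True
    with bwd[OF S2 cycle_gain_graph_step(4,3)[OF G]] n show ?thesis
      by (simp add: cyc_pred_def)
  next
    case False
    with bwd[OF S1[of k] cycle_gain_graph_step(2,1)[OF G]] k show ?thesis
      by (simp add: cyc_pred_def)
  qed
qed

lemma mset_map_upt_image: "mset (map f [0..<n]) = image_mset f (mset_set {0..<n})"
  by simp

context star_embedding
begin

lemma switched_cycle_eigenvalues:
  assumes n: "3 \<le> n" and G: "cycle_gain_graph n \<phi>"
    and S: "switches_cycle_to n \<phi> \<zeta> (H (dual_cis \<theta>))"
  shows "has_eigenvalues (gain_adjacency_mat n (cycle_edges n) \<phi>)
      {# 2 * dual_cos (cycle_angle n \<theta> j). j \<in># mset_set {0..<n} #}" (is ?adj)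
    and "has_eigenvalues (gain_laplacian_mat n (cycle_edges n) \<phi>)
      {# 2 - 2 * dual_cos (cycle_angle n \<theta> j). j \<in># mset_set {0..<n} #}" (is ?lap)
proof -
  let ?A = "gain_adjacency_mat n (cycle_edges n) \<phi>"
  let ?w = "dual_fourier n \<theta>"
  define s :: "complex dual" where "s = dual_of_real (Dual (1 / sqrt (real n)) 0)"
  define U where "U = mat n n (\<lambda>(k, j). \<zeta> (Suc k) * H (s * ?w j k))"
  have s: "conjugate s = s" "s * s * of_nat n = 1"
    using n by (simp_all add: s_def dual_eq_iff dual.map_sel flip: of_real_mult)
  have U: "U \<in> carrier_mat n n" by (simp add: U_def)
  have A: "?A \<in> carrier_mat n n" by (simp add: gain_adjacency_mat_def)
  have Z: "\<zeta> (Suc k) \<in> dual_units" if "k < n" for k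
    using S that by (simp add: switches_cycle_to_def switching_function_def)
  have "conj_transpose U * U = 1\<^sub>m n"
  proof (rule eq_matI)
    fix i j assume "i < dim_row (1\<^sub>m n :: 'a dual mat)" "j < dim_col (1\<^sub>m n :: 'a dual mat)"
    then have ij: "i < n" "j < n" by simp_all
    have "(conj_transpose U * U) $$ (i, j) =
        (\<Sum>k<n. conjugate (\<zeta> (Suc k) * H (s * ?w i k)) * (\<zeta> (Suc k) * H (s * ?w j k)))"
      using ij U by (simp add: conj_transpose_def scalar_prod_def U_def lessThan_atLeast0)
    also have "\<dots> = (\<Sum>k<n. H (s * s * (conjugate (?w i k) * ?w j k)))"
    proof (rule sum.cong)
      fix k assume "k \<in> {..<n}"
      then have "conjugate (\<zeta> (Suc k)) * \<zeta> (Suc k) = 1" by (simp add: dual_units_inverse Z)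
      then have "conjugate (\<zeta> (Suc k) * H (s * ?w i k)) * (\<zeta> (Suc k) * H (s * ?w j k)) =
          conjugate (H (s * ?w i k)) * H (s * ?w j k)"
        by (simp add: conjugate_dual_mult mult.assoc)
           (simp add: mult.assoc[of "conjugate (\<zeta> (Suc k))", symmetric])
      also have "\<dots> = H (s * s * (conjugate (?w i k) * ?w j k))"
        by (simp add: conjugate_dual_mult s mult_ac flip: H_conjugate H_mult)
      finally show "conjugate (\<zeta> (Suc k) * H (s * ?w i k)) * (\<zeta> (Suc k) * H (s * ?w j k)) = \<dots>" .
    qed simp
    also have "\<dots> = H (s * s * (\<Sum>k<n. conjugate (?w i k) * ?w j k))"
      by (simp only: H_sum sum_distrib_left)
    finally show "(conj_transpose U * U) $$ (i, j) = 1\<^sub>m n $$ (i, j)"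
      using ij s by (simp add: dual_fourier_orthogonal_columns)
  qed (use U in \<open>simp_all add: conj_transpose_def\<close>)
  moreover have "U * conj_transpose U = 1\<^sub>m n"
  proof (rule eq_matI)
    fix k l assume "k < dim_row (1\<^sub>m n :: 'a dual mat)" "l < dim_col (1\<^sub>m n :: 'a dual mat)"
    then have kl: "k < n" "l < n" by simp_all
    have "(U * conj_transpose U) $$ (k, l) =
        (\<Sum>j<n. (\<zeta> (Suc k) * H (s * ?w j k)) * conjugate (\<zeta> (Suc l) * H (s * ?w j l)))"
      using kl U by (simp add: conj_transpose_def scalar_prod_def U_def lessThan_atLeast0)
    also have "\<dots> = (\<Sum>j<n. \<zeta> (Suc k) * H (s * s * (?w j k * conjugate (?w j l))) * conjugate (\<zeta> (Suc l)))"
    proof (rule sum.cong)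
      fix j
      have "H (s * ?w j k) * conjugate (H (s * ?w j l)) = H (s * s * (?w j k * conjugate (?w j l)))"
        by (simp add: conjugate_dual_mult s mult_ac flip: H_conjugate H_mult)
      then show "(\<zeta> (Suc k) * H (s * ?w j k)) * conjugate (\<zeta> (Suc l) * H (s * ?w j l)) =
          \<zeta> (Suc k) * H (s * s * (?w j k * conjugate (?w j l))) * conjugate (\<zeta> (Suc l))"
        by (simp only: conjugate_dual_mult[of "\<zeta> (Suc l)"] mult.assoc) (simp flip: mult.assoc)
    qed simp
    also have "\<dots> = \<zeta> (Suc k) * H (s * s * (\<Sum>j<n. ?w j k * conjugate (?w j l))) * conjugate (\<zeta> (Suc l))"
      by (simp only: H_sum sum_distrib_left sum_distrib_right)
    finally show "(U * conj_transpose U) $$ (k, l) = 1\<^sub>m n $$ (k, l)"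
      using kl s by (simp add: dual_fourier_orthogonal_rows dual_units_inverse Z)
  qed (use U in \<open>simp_all add: conj_transpose_def\<close>)
  ultimately have unitary: "unitary_mat n U" using U by (simp add: unitary_mat_def)
  have entry: "(?A * U) $$ (k, j) = U $$ (k, j) * dual_of_real (2 * dual_cos (cycle_angle n \<theta> j))"
    if kj: "k < n" "j < n" for k j
  proof -
    let ?g = "\<lambda>l. \<phi> (Suc k) (Suc l) * \<zeta> (Suc l) * H (s * ?w j l)"
    let ?p = "if Suc k = n then dual_cis \<theta> else 1" and ?q = "if k = 0 then dual_cis (- \<theta>) else 1"
    have "(?A * U) $$ (k, j) = (\<Sum>l<n. if {Suc k, Suc l} \<in> cycle_edges n then ?g l else 0)"
      using kj A U by (auto simp: scalar_prod_def U_def gain_adjacency_mat_def lessThan_atLeast0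
          mult.assoc intro!: sum.cong)
    also have "\<dots> = (\<Sum>l\<in>{cyc_succ n k, cyc_pred n k}. ?g l)"
      using n kj
      by (intro sum.mono_neutral_cong_right)
         (auto simp: cycle_edges_iff cyc_succ_less cyc_pred_less)
    also have "\<dots> = ?g (cyc_succ n k) + ?g (cyc_pred n k)"
      using cyc_succ_neq_pred[OF n kj(1)] by simp
    also have "\<dots> = \<zeta> (Suc k) * H (s * (?p * ?w j (cyc_succ n k) + ?q * ?w j (cyc_pred n k)))"
      using switched_gain[OF n kj(1) G S]
      by (simp add: H_mult H_add distrib_left mult.assoc[symmetric] if_distrib[of H]
          conjugate_dual_cis flip: H_conjugate) (simp add: mult.assoc H_mult[symmetric] mult.commute[of s])
    also have "?p * ?w j (cyc_succ n k) + ?q * ?w j (cyc_pred n k) =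
        ?w j k * dual_of_real (2 * dual_cos (cycle_angle n \<theta> j))"
      unfolding dual_fourier_succ[OF kj(1)] dual_fourier_pred[OF kj(1)]
        dual_cis_plus_conjugate[symmetric] by (simp add: algebra_simps)
    finally show ?thesis
      using kj by (simp add: U_def H_mult H_dual_of_real mult.assoc)
  qed
  have AU: "?A * U = U * mat_diag n (\<lambda>i. dual_of_real (map (\<lambda>j. 2 * dual_cos (cycle_angle n \<theta> j)) [0..<n] ! i))"
    by (rule eq_matI) (use A U in \<open>auto simp: entry mat_diag_mult_right[of _ n n] simp del: index_mult_mat(1)\<close>)
  show ?adj
    using has_eigenvaluesI[OF A unitary _ AU] by (simp only: mset_map_upt_image) simp
  let ?L = "gain_laplacian_mat n (cycle_edges n) \<phi>"
  have L: "?L \<in> carrier_mat n n"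
    unfolding gain_laplacian_mat_def using A by (intro minus_carrier_mat)
  have Lentry: "(?L * U) $$ (k, j) = U $$ (k, j) * dual_of_real (2 - 2 * dual_cos (cycle_angle n \<theta> j))"
    if kj: "k < n" "j < n" for k j
  proof -
    have "?L * U = mat_diag n (\<lambda>i. of_nat (graph_degree (cycle_edges n) (Suc i))) * U - ?A * U"
      unfolding gain_laplacian_mat_def using A U by (intro minus_mult_distrib_mat) auto
    then have "(?L * U) $$ (k, j) = 2 * U $$ (k, j) - (?A * U) $$ (k, j)"
      using kj A U n by (simp add: mat_diag_mult_left[of _ n n] graph_degree_cycle)
    moreover have "dual_of_real (2 - x) = 2 - (dual_of_real x :: 'a dual)" for x
      by (simp add: dual_eq_iff dual.map_sel)
    ultimately show ?thesis
      using kj mult_2[of "U $$ (k, j)"] mult_2_right[of "U $$ (k, j)"]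
      by (simp only: entry right_diff_distrib)
  qed
  have LU: "?L * U = U * mat_diag n (\<lambda>i. dual_of_real (map (\<lambda>j. 2 - 2 * dual_cos (cycle_angle n \<theta> j)) [0..<n] ! i))"
    by (rule eq_matI) (use L U in \<open>auto simp: Lentry mat_diag_mult_right[of _ n n] simp del: index_mult_mat(1)\<close>)
  show ?lap
    using has_eigenvaluesI[OF L unitary _ LU] by (simp only: mset_map_upt_image) simp
qed

end

section \<open>Dual angles and conjugation of unit dual quaternions\<close>

lemma dual_unit_ex_angle:
  assumes "p \<in> dual_units"
  shows "\<exists>\<theta>. dual_of_real \<theta> = - dual_i * dual_log p \<and> p = dual_cis \<theta>"
proof -
  have "inverse (std_part p) = cnj (std_part p)"
    using arg_cong[OF dual_units_inverse(1)[OF assms], of std_part] by (simp add: inverse_dual_def)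
  moreover have u: "conjugate p * p = 1" using assms by (simp add: dual_units_iff)
  have n: "cnj (std_part p) * std_part p = 1"
    using arg_cong[OF u, of std_part] by simp
  then have nz: "std_part p \<noteq> 0" by auto
  have "norm (std_part p) = 1"
    using n by (metis complex_mod_sqrt_Re_mult_cnj mult.commute one_complex.sel(1) real_sqrt_one)
  moreover have "Re (cnj (std_part p) * dual_part p) = 0"
    using arg_cong[OF u, of "\<lambda>x. Re (dual_part x)"] by (simp add: algebra_simps)
  ultimately have "dual_of_real (map_dual Re (- dual_i * dual_log p)) = - dual_i * dual_log p"
    using nz by (simp add: dual_eq_iff dual.map_sel dual_log_def complex_eq_iff)
  moreover have "p = dual_exp (dual_i * (- dual_i * dual_log p))"
    using nz by (simp add: dual_eq_iff dual_exp_def dual_log_def flip: mult.assoc)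
  ultimately show ?thesis by metis
qed

lemma quat_similar_complex:
  "\<exists>u z. norm u = 1 \<and> q * u = u * quat_of_complex z"
proof -
  have "\<exists>u z. u \<noteq> 0 \<and> q * u = u * quat_of_complex z"
  proof (cases "QIm2 q = 0 \<and> QIm3 q = 0")
    case True
    then show ?thesis
      by (intro exI[of _ 1] exI[of _ "Complex (QRe q) (QIm1 q)"])
         (simp add: quat_eq_iff times_quat_def one_quat_def zero_quat_def quat_of_complex_def)
  next
    case False
    define m where "m = sqrt ((QIm1 q)\<^sup>2 + (QIm2 q)\<^sup>2 + (QIm3 q)\<^sup>2)"
    have m: "m * m = QIm1 q * QIm1 q + QIm2 q * QIm2 q + QIm3 q * QIm3 q"
      by (simp add: m_def flip: power2_eq_square)
    \<comment> \<open>For \<open>v\<close> the imaginary part of \<open>q\<close> and \<open>m = |v|\<close>, both \<open>v * (v + m i)\<close> and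
      \<open>(v + m i) * (m i)\<close> equal \<open>m v i - m\<^sup>2\<close>.\<close>
    show ?thesis
      using False m
      by (intro exI[of _ "Quat 0 (QIm1 q + m) (QIm2 q) (QIm3 q)"] exI[of _ "Complex (QRe q) m"])
         (auto simp: quat_eq_iff times_quat_def zero_quat_def quat_of_complex_def algebra_simps)
  qed
  then obtain u z where "u \<noteq> 0" "q * u = u * quat_of_complex z" by blast
  then show ?thesis
    by (intro exI[of _ "u /\<^sub>R norm u"] exI[of _ z]) simp
qed

lemma Dual_unit: "norm u = 1 \<Longrightarrow> Dual u 0 \<in> dual_units" for u :: "'a::star_div_algebra"
  by (simp add: dual_units_iff dual_eq_iff conjugate_mult_self conjugate_zero_star)

lemma dual_quat_similar_complex:
  fixes q :: "quat dual"
  shows "\<exists>u\<in>dual_units. \<exists>a. q * u = u * map_dual quat_of_complex a"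
proof -
  obtain v z where v: "norm v = 1" "std_part q * v = v * quat_of_complex z"
    using quat_similar_complex by blast
  define V where "V = Dual v 0"
  have V: "V \<in> dual_units" using v by (simp add: V_def Dual_unit)
  define c where "c = conjugate V * q * V"
  have qV: "q * V = V * c"
    using dual_units_inverse(2)[OF V] by (simp add: c_def flip: mult.assoc)
  have c: "std_part c = quat_of_complex z"
  proof -
    have "std_part c = conjugate v * v * quat_of_complex z"
      by (simp add: c_def V_def mult.assoc v)
    then show ?thesis by (simp add: conjugate_mult_self v)
  qed
  define d where "d = dual_part c"
  have "\<exists>w\<in>dual_units. \<exists>a. c * w = w * map_dual quat_of_complex a"
  proof (cases "Im z = 0")
    case True
    \<comment> \<open>Now the standard part is real, hence central, and only the dual part has to be rotated.\<close>
    obtain w y where w: "norm w = 1" "d * w = w * quat_of_complex y"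
      using quat_similar_complex by blast
    have "quat_of_complex z * w = w * quat_of_complex z"
      using True by (simp add: quat_eq_iff times_quat_def quat_of_complex_def)
    then have "c * Dual w 0 = Dual w 0 * map_dual quat_of_complex (Dual z y)"
      using w by (simp add: dual_eq_iff c d_def[symmetric])
    then show ?thesis using w Dual_unit by blast
  next
    case False
    \<comment> \<open>Conjugation by \<open>1 + x \<epsilon>\<close> adds the commutator of \<open>z\<close> and \<open>x\<close> to the dual part; on the span
      of \<open>j\<close> and \<open>k\<close> this commutator is left multiplication by \<open>2 i Im z\<close>, hence onto.\<close>
    define w where "w = Dual 1 (Quat 0 0 (- QIm3 d / (2 * Im z)) (QIm2 d / (2 * Im z)))"
    have "w \<in> dual_units"
      by (simp add: w_def dual_units_iff dual_eq_iff)
         (simp add: quat_eq_iff conjugate_quat_def zero_quat_def plus_quat_def)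
    moreover have "c * w = w * map_dual quat_of_complex (Dual z (Complex (QRe d) (QIm1 d)))"
      using False
      by (simp add: dual_eq_iff c d_def[symmetric] w_def)
         (simp add: quat_eq_iff times_quat_def plus_quat_def quat_of_complex_def field_simps)
    ultimately show ?thesis by blast
  qed
  then obtain w a where w: "w \<in> dual_units" "c * w = w * map_dual quat_of_complex a" by blast
  have "q * (V * w) = (V * w) * map_dual quat_of_complex a"
    using qV w(2) by (metis mult.assoc)
  then show ?thesis using dual_units_mult[OF V w(1)] by blast
qed

lemma cycle_switching:
  assumes "cycle_gain_graph n \<phi>" "1 \<le> n"
  shows "\<exists>\<zeta>. switches_cycle_to n \<phi> \<zeta> (cycle_gain n \<phi>)"
  using ex_switches_cycle_to[OF assms dual_units_one] by simp

lemma star_embedding_complex: "star_embedding (\<lambda>z. z)"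
  by (simp add: star_embedding_def)

lemma star_embedding_quat: "star_embedding quat_of_complex"
  by (simp add: star_embedding_def quat_of_complex_def quat_eq_iff plus_quat_def times_quat_def
      of_real_def scaleR_quat_def one_quat_def conjugate_quat_def)

lemma dual_unit_quat_similar_complex:
  fixes q :: "quat dual"
  assumes "q \<in> dual_units"
  shows "\<exists>u\<in>dual_units. \<exists>a\<in>dual_units. conjugate u * q * u = map_dual quat_of_complex a"
proof -
  obtain u a where u: "u \<in> dual_units" and a: "q * u = u * map_dual quat_of_complex a"
    using dual_quat_similar_complex by blast
  have "conjugate u * q * u = conjugate u * u * map_dual quat_of_complex a"
    by (simp only: mult.assoc a)
  then have *: "conjugate u * q * u = map_dual quat_of_complex a"
    using u by (simp add: dual_units_inverse)
  have "map_dual quat_of_complex a \<in> dual_units"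
    unfolding *[symmetric] using assms u by (intro dual_units_mult dual_units_conjugate)
  then have "map_dual quat_of_complex (conjugate a * a) = map_dual quat_of_complex 1"
    by (simp only: dual_units_iff star_embedding.H_mult[OF star_embedding_quat]
        star_embedding.H_conjugate[OF star_embedding_quat] star_embedding.H_one[OF star_embedding_quat])
  moreover have "inj (map_dual quat_of_complex)"
    by (intro dual.inj_map injI) (simp add: quat_of_complex_def complex_eq_iff)
  ultimately have "a \<in> dual_units" by (simp add: dual_units_iff inj_eq)
  with u * show ?thesis by blast
qed

theorem theorem3p4:
  fixes n :: nat
  assumes "n \<ge> 3"
  shows
    "(\<forall>\<phi> :: nat \<Rightarrow> nat \<Rightarrow> real dual. cycle_gain_graph n \<phi> \<longrightarrow>
        cycle_gain n \<phi> \<in> dual_units \<and> (\<exists>\<zeta>. switches_cycle_to n \<phi> \<zeta> (cycle_gain n \<phi>))) \<and>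
     (\<forall>\<phi> :: nat \<Rightarrow> nat \<Rightarrow> complex dual. cycle_gain_graph n \<phi> \<longrightarrow>
        cycle_gain n \<phi> \<in> dual_units \<and> (\<exists>\<zeta>. switches_cycle_to n \<phi> \<zeta> (cycle_gain n \<phi>))) \<and>
     (\<forall>\<phi> :: nat \<Rightarrow> nat \<Rightarrow> quat dual. cycle_gain_graph n \<phi> \<longrightarrow>
        cycle_gain n \<phi> \<in> dual_units \<and> (\<exists>\<zeta>. switches_cycle_to n \<phi> \<zeta> (cycle_gain n \<phi>))) \<and>
     (\<forall>\<phi> :: nat \<Rightarrow> nat \<Rightarrow> complex dual. cycle_gain_graph n \<phi> \<longrightarrow>
        (\<exists>\<theta>. dual_of_real \<theta> = - dual_i * dual_log (cycle_gain n \<phi>) \<and>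
             cycle_gain n \<phi> = dual_exp (dual_i * dual_of_real \<theta>)) \<and>
        (\<forall>\<theta>. cycle_gain n \<phi> = dual_exp (dual_i * dual_of_real \<theta>) \<longrightarrow>
           has_eigenvalues (gain_adjacency_mat n (cycle_edges n) \<phi>)
             {# 2 * dual_cos ((\<theta> + Dual (2 * pi * real j) 0) / of_nat n). j \<in># mset_set {0..<n} #} \<and>
           has_eigenvalues (gain_laplacian_mat n (cycle_edges n) \<phi>)
             {# 2 - 2 * dual_cos ((\<theta> + Dual (2 * pi * real j) 0) / of_nat n). j \<in># mset_set {0..<n} #})) \<and>
     (\<forall>\<phi> :: nat \<Rightarrow> nat \<Rightarrow> quat dual. cycle_gain_graph n \<phi> \<longrightarrow>
        (\<exists>a \<in> dual_units. \<exists>\<zeta>\<^sub>1.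
           switches_cycle_to n \<phi> \<zeta>\<^sub>1 (map_dual quat_of_complex a) \<and>
           (\<exists>\<theta>. dual_of_real \<theta> = - dual_i * dual_log a \<and>
                a = dual_exp (dual_i * dual_of_real \<theta>)) \<and>
           (\<forall>\<theta>. a = dual_exp (dual_i * dual_of_real \<theta>) \<longrightarrow>
              has_eigenvalues (gain_adjacency_mat n (cycle_edges n) \<phi>)
                {# 2 * dual_cos ((\<theta> + Dual (2 * pi * real j) 0) / of_nat n). j \<in># mset_set {0..<n} #} \<and>
              has_eigenvalues (gain_laplacian_mat n (cycle_edges n) \<phi>)
                {# 2 - 2 * dual_cos ((\<theta> + Dual (2 * pi * real j) 0) / of_nat n). j \<in># mset_set {0..<n} #})))"
proof (intro conjI allI impI)
  have n: "1 \<le> n" using assms by simp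
  {
    fix \<phi> :: "nat \<Rightarrow> nat \<Rightarrow> real dual"
    assume "cycle_gain_graph n \<phi>"
    then show "cycle_gain n \<phi> \<in> dual_units" "\<exists>\<zeta>. switches_cycle_to n \<phi> \<zeta> (cycle_gain n \<phi>)"
      using cycle_gain_unit cycle_switching n by blast+
  next
    fix \<phi> :: "nat \<Rightarrow> nat \<Rightarrow> complex dual"
    assume G: "cycle_gain_graph n \<phi>"
    then show unit: "cycle_gain n \<phi> \<in> dual_units"
      and ex: "\<exists>\<zeta>. switches_cycle_to n \<phi> \<zeta> (cycle_gain n \<phi>)"
      using cycle_gain_unit cycle_switching n by blast+
    show "\<exists>\<theta>. dual_of_real \<theta> = - dual_i * dual_log (cycle_gain n \<phi>) \<and> cycle_gain n \<phi> = dual_cis \<theta>"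
      using dual_unit_ex_angle[OF unit] .
    fix \<theta> assume "cycle_gain n \<phi> = dual_cis \<theta>"
    with ex obtain \<zeta> where "switches_cycle_to n \<phi> \<zeta> (map_dual (\<lambda>z. z) (dual_cis \<theta>))"
      by (auto simp: dual.map_ident)
    note star_embedding.switched_cycle_eigenvalues[OF star_embedding_complex assms G this]
    then show "has_eigenvalues (gain_adjacency_mat n (cycle_edges n) \<phi>)
        {# 2 * dual_cos ((\<theta> + Dual (2 * pi * real j) 0) / of_nat n). j \<in># mset_set {0..<n} #}"
      "has_eigenvalues (gain_laplacian_mat n (cycle_edges n) \<phi>)
        {# 2 - 2 * dual_cos ((\<theta> + Dual (2 * pi * real j) 0) / of_nat n). j \<in># mset_set {0..<n} #}"
      unfolding cycle_angle_def .
  next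
    fix \<phi> :: "nat \<Rightarrow> nat \<Rightarrow> quat dual"
    assume G: "cycle_gain_graph n \<phi>"
    then show unit: "cycle_gain n \<phi> \<in> dual_units"
      and "\<exists>\<zeta>. switches_cycle_to n \<phi> \<zeta> (cycle_gain n \<phi>)"
      using cycle_gain_unit cycle_switching n by blast+
    obtain u a where u: "u \<in> dual_units" and a: "a \<in> dual_units"
      and ua: "conjugate u * cycle_gain n \<phi> * u = map_dual quat_of_complex a"
      using dual_unit_quat_similar_complex[OF unit] by blast
    obtain \<zeta> where \<zeta>: "switches_cycle_to n \<phi> \<zeta> (map_dual quat_of_complex a)"
      using ex_switches_cycle_to[OF G n u] ua by auto
    show "\<exists>a\<in>dual_units. \<exists>\<zeta>\<^sub>1.
        switches_cycle_to n \<phi> \<zeta>\<^sub>1 (map_dual quat_of_complex a) \<and>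
        (\<exists>\<theta>. dual_of_real \<theta> = - dual_i * dual_log a \<and> a = dual_cis \<theta>) \<and>
        (\<forall>\<theta>. a = dual_cis \<theta> \<longrightarrow>
          has_eigenvalues (gain_adjacency_mat n (cycle_edges n) \<phi>)
            {# 2 * dual_cos ((\<theta> + Dual (2 * pi * real j) 0) / of_nat n). j \<in># mset_set {0..<n} #} \<and>
          has_eigenvalues (gain_laplacian_mat n (cycle_edges n) \<phi>)
            {# 2 - 2 * dual_cos ((\<theta> + Dual (2 * pi * real j) 0) / of_nat n). j \<in># mset_set {0..<n} #})"
    proof (intro bexI[OF _ a] exI[of _ \<zeta>] conjI allI impI \<zeta>)
      show "\<exists>\<theta>. dual_of_real \<theta> = - dual_i * dual_log a \<and> a = dual_cis \<theta>"
        using dual_unit_ex_angle[OF a] .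
      fix \<theta> assume "a = dual_cis \<theta>"
      with \<zeta> have "switches_cycle_to n \<phi> \<zeta> (map_dual quat_of_complex (dual_cis \<theta>))" by simp
      note star_embedding.switched_cycle_eigenvalues[OF star_embedding_quat assms G this]
      then show "has_eigenvalues (gain_adjacency_mat n (cycle_edges n) \<phi>)
          {# 2 * dual_cos ((\<theta> + Dual (2 * pi * real j) 0) / of_nat n). j \<in># mset_set {0..<n} #}"
        "has_eigenvalues (gain_laplacian_mat n (cycle_edges n) \<phi>)
          {# 2 - 2 * dual_cos ((\<theta> + Dual (2 * pi * real j) 0) / of_nat n). j \<in># mset_set {0..<n} #}"
        unfolding cycle_angle_def .
    qed
  }
qed

end
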